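(* Let $G$ be a group and let $F$ be a subgroup of the group $S(G)$ of all bijective maps $G\to G$ under composition. The following statements are equivalent. (1) $G$ is $F$-amenable. (2) There exists no $F$-paradoxical decomposition of $G$.
   Context: $\ell_\infty(G)$ is the space of bounded real-valued functions on $G$. $G$ is called $F$-amenable if there is a mean $M$ on $\ell_\infty(G)$ (a positive linear functional with $M(1)=1$) with $M(f\circ\varphi)=M(f)$ for all $f\in\ell_\infty(G)$, $\varphi\in F$. An $F$-paradoxical decomposition $(\varphi_i,\psi_j;A_i,B_j)$ of $G$ consists of a partition $\{A_1,\ldots,A_n;B_1,\ldots,B_m\}$ of $G$ (the sets $A_i,B_j$ are pairwise disjoint with union $G$) together with elements $\varphi_1,\ldots,\varphi_n$ and $\psi_1,\ldots,\psi_m$ of $F$ such that $$G=\varphi_1(A_1)\cup\cdots\cup\varphi_n(A_n)=\psi_1(B_1)\cup\cdots\cup\psi_m(B_m).$$ *)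

theory Defs
  imports "HOL-Analysis.Analysis" "HOL-Algebra.Bij"
begin

(* A function on the carrier of G is represented by its unique extensional extension, in the
   same way as the elements of BijGroup (carrier G), so that equality is equality of functions
   on the carrier. *)
definition l_infty :: "('a, 'b) monoid_scheme \<Rightarrow> ('a \<Rightarrow> real) set" where
  "l_infty G = {f \<in> extensional (carrier G). bounded (f ` carrier G)}"

(* Only the values of M on l_infty G matter. *)
definition mean_on :: "('a, 'b) monoid_scheme \<Rightarrow> (('a \<Rightarrow> real) \<Rightarrow> real) \<Rightarrow> bool" where
  "mean_on G M \<longleftrightarrow>
     (\<forall>f\<in>l_infty G. \<forall>g\<in>l_infty G. M (\<lambda>x\<in>carrier G. f x + g x) = M f + M g) \<and>
     (\<forall>c. \<forall>f\<in>l_infty G. M (\<lambda>x\<in>carrier G. c * f x) = c * M f) \<and>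
     (\<forall>f\<in>l_infty G. (\<forall>x\<in>carrier G. 0 \<le> f x) \<longrightarrow> 0 \<le> M f) \<and>
     M (\<lambda>x\<in>carrier G. 1) = 1"

definition F_amenable :: "('a, 'b) monoid_scheme \<Rightarrow> ('a \<Rightarrow> 'a) set \<Rightarrow> bool" where
  "F_amenable G F \<longleftrightarrow>
     (\<exists>M. mean_on G M \<and>
        (\<forall>f\<in>l_infty G. \<forall>\<phi>\<in>F. M (compose (carrier G) f \<phi>) = M f))"

(* The images need only cover the carrier; they are not required to be disjoint.
   Individual pieces may be empty. *)
definition paradoxical_decomposition ::
  "('a, 'b) monoid_scheme \<Rightarrow> ('a \<Rightarrow> 'a) set \<Rightarrow> nat \<Rightarrow> nat \<Rightarrow>
   (nat \<Rightarrow> 'a \<Rightarrow> 'a) \<Rightarrow> (nat \<Rightarrow> 'a \<Rightarrow> 'a) \<Rightarrow> (nat \<Rightarrow> 'a set) \<Rightarrow> (nat \<Rightarrow> 'a set) \<Rightarrow> bool" where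
  "paradoxical_decomposition G F n m \<phi> \<psi> A B \<longleftrightarrow>
     disjoint_family_on A {1..n} \<and> disjoint_family_on B {1..m} \<and>
     (\<forall>i\<in>{1..n}. \<forall>j\<in>{1..m}. A i \<inter> B j = {}) \<and>
     (\<Union>i\<in>{1..n}. A i) \<union> (\<Union>j\<in>{1..m}. B j) = carrier G \<and>
     (\<forall>i\<in>{1..n}. \<phi> i \<in> F) \<and> (\<forall>j\<in>{1..m}. \<psi> j \<in> F) \<and>
     carrier G = (\<Union>i\<in>{1..n}. \<phi> i ` A i) \<and>
     carrier G = (\<Union>j\<in>{1..m}. \<psi> j ` B j)"

end

theory Submission
  imports Defs
begin

text \<open>
An invariant mean turns sets into numbers: it assigns to every \<open>S\<close> the mean of its indicator, and a
piece and its image under an element of \<open>F\<close> get the same number. The two families of a paradoxical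
decomposition would each have total mass at least 1, because their images cover the carrier, while
together they have total mass at most 1, because they are disjoint
(\<open>F_amenable_imp_not_paradoxical\<close>).

For the converse, write \<open>K E\<close> for the set of all images of points of \<open>E\<close> under elements of \<open>K\<close>.
Suppose that some finite \<open>K \<subseteq> F\<close> doubles, that is, \<open>K E\<close> has at least twice as many elements as
\<open>E\<close>, for every finite \<open>E\<close>. Then Hall's condition holds for the problem of assigning to every
point \<open>x\<close> two private points of the finite set \<open>K {x}\<close>, and the marriage theorem, in its form for
infinite families of finite sets, solves it. The first choices and the second choices are disjoint
copies of the whole set; cut up according to the element of \<open>K\<close> that was used, and moved back by
its inverse, they form a paradoxical decomposition (\<open>doubling_imp_paradoxical\<close>).

If no finite subset of \<open>F\<close> doubles, then no power of a given \<open>K\<close> does. For every high power there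
is then a set \<open>E\<close> along whose translates \<open>E, K E, K (K E), \<dots>\<close> the size does not even double, so
it grows by a factor close to 1 at some step, where the set is nearly \<open>K\<close>-invariant: a Folner set
(\<open>Folner_if_not_doubling\<close>).
Averages over Folner sets are nearly invariant means. The means with prescribed bounds on their
values form a compact set in the product topology, and approximate invariance is a closed
condition, so an exactly invariant mean exists (\<open>Folner_imp_F_amenable\<close>).
\<close>

section \<open>The marriage theorem for infinite families of finite sets\<close>

text \<open>
Rado's argument, which treats finite and infinite families alike. By Zorn's lemma, as many pairs as
possible are removed from the membership relation without violating Hall's condition; the finiteness
of the sets makes the condition survive the union of a chain of removals, since a finite subfamily
only sees finitely many pairs. What remains is single-valued: if \<open>x\<close> and \<open>y\<close> were both left for
\<open>i\<close>, then by maximality the removal of either would violate the condition at finite subfamilies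
\<open>J\<close> and \<open>L\<close>, and the sizes of the union and the intersection of what these subfamilies then see
would contradict the condition for \<open>J \<union> L\<close> and \<open>J \<inter> L - {i}\<close>.
\<close>

theorem marriage:
  assumes fin: "\<And>i. i \<in> I \<Longrightarrow> finite (N i)"
    and hall: "\<And>J. J \<subseteq> I \<Longrightarrow> finite J \<Longrightarrow> card J \<le> card (\<Union>j\<in>J. N j)"
  obtains f where "inj_on f I" "\<And>i. i \<in> I \<Longrightarrow> f i \<in> N i"
proof -
  define R where "R = Sigma I N"
  define \<A> where "\<A> = {D. \<forall>J\<subseteq>I. finite J \<longrightarrow> card J \<le> card ((R - D) `` J)}"
  have finR: "finite (R `` J)" if "finite J" for J
  proof -
    have "R `` J \<subseteq> (\<Union>j\<in>J \<inter> I. N j)" by (auto simp: R_def)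
    then show ?thesis by (rule finite_subset) (use that fin in auto)
  qed
  have "R `` J = (\<Union>j\<in>J. N j)" if "J \<subseteq> I" for J
    using that by (auto simp: R_def)
  then have "{} \<in> \<A>" using hall by (simp add: \<A>_def)
  moreover have "\<Union>\<C> \<in> \<A>" if "\<C> \<noteq> {}" and ch: "subset.chain \<A> \<C>" for \<C>
  proof -
    have "card J \<le> card ((R - \<Union>\<C>) `` J)" if J: "J \<subseteq> I" "finite J" for J
    proof -
      define Q where "Q = R \<inter> J \<times> UNIV"
      have "Q \<subseteq> J \<times> (R `` J)" by (auto simp: Q_def)
      then have "finite Q" by (rule finite_subset) (use finR J in auto)
      then have "finite (Q \<inter> \<Union>\<C>)" by blast
      then obtain C where C: "C \<in> \<C>" "Q \<inter> \<Union>\<C> \<subseteq> C"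
        using finite_subset_Union_chain[OF _ _ \<open>\<C> \<noteq> {}\<close> ch] by (metis inf_le2)
      have "(R - \<Union>\<C>) `` J = (R - C) `` J" using C by (auto simp: Q_def)
      moreover have "C \<in> \<A>" using ch C by (auto simp: subset.chain_def)
      ultimately show ?thesis using J by (simp add: \<A>_def)
    qed
    then show ?thesis by (simp add: \<A>_def)
  qed
  ultimately obtain D where D: "D \<in> \<A>" and max: "\<And>X. X \<in> \<A> \<Longrightarrow> D \<subseteq> X \<Longrightarrow> X = D"
    using subset_Zorn_nonempty[of \<A>] by blast
  define S where "S = R - D"
  have hallS: "card J \<le> card (S `` J)" if "J \<subseteq> I" "finite J" for J
    using D that by (simp add: \<A>_def S_def)
  have finS: "finite (S `` J)" if "finite J" for J
    by (rule finite_subset[OF _ finR[OF that]]) (auto simp: S_def)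
  \<comment> \<open>By maximality, every remaining pair is needed at some finite subfamily.\<close>
  have critical: "\<exists>J\<subseteq>I. finite J \<and> i \<in> J \<and> card ((S - {(i, z)}) `` J) < card J"
    if "(i, z) \<in> S" for i z
  proof -
    have "insert (i, z) D \<notin> \<A>" using max[of "insert (i, z) D"] that by (auto simp: S_def)
    moreover have "R - insert (i, z) D = S - {(i, z)}" by (auto simp: S_def)
    ultimately obtain J where J: "J \<subseteq> I" "finite J" "card ((S - {(i, z)}) `` J) < card J"
      by (auto simp: \<A>_def not_le)
    have "i \<in> J"
    proof (rule ccontr)
      assume "i \<notin> J"
      then have "(S - {(i, z)}) `` J = S `` J" by auto
      then show False using J hallS[of J] by simp
    qed
    with J show ?thesis by blast
  qed
  have unique: "x = y" if xS: "(i, x) \<in> S" and yS: "(i, y) \<in> S" for i x y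
  proof (rule ccontr)
    assume "x \<noteq> y"
    obtain J where J: "J \<subseteq> I" "finite J" "i \<in> J" "card ((S - {(i, x)}) `` J) < card J"
      using critical[OF xS] by blast
    obtain L where L: "L \<subseteq> I" "finite L" "i \<in> L" "card ((S - {(i, y)}) `` L) < card L"
      using critical[OF yS] by blast
    let ?A = "(S - {(i, x)}) `` J" and ?B = "(S - {(i, y)}) `` L"
    have fA: "finite ?A" by (rule finite_subset[OF _ finS[OF J(2)]]) auto
    have fB: "finite ?B" by (rule finite_subset[OF _ finS[OF L(2)]]) auto
    have "S `` (J \<union> L) \<subseteq> ?A \<union> ?B"
      using \<open>x \<noteq> y\<close> xS yS J(3) L(3) by auto
    then have "card (J \<union> L) \<le> card (?A \<union> ?B)"
      using hallS[of "J \<union> L"] J L fA fB by (meson Un_least card_mono finite_UnI le_trans)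
    moreover have "S `` (J \<inter> L - {i}) \<subseteq> ?A \<inter> ?B" by auto
    then have "card (J \<inter> L - {i}) \<le> card (?A \<inter> ?B)"
      using hallS[of "J \<inter> L - {i}"] J L fA
      by (meson card_mono finite_Diff finite_Int inf_le1 le_trans subset_trans Diff_subset)
    moreover have "card (J \<inter> L) = Suc (card (J \<inter> L - {i}))"
      using J L by (metis IntI card.remove finite_Int)
    \<comment> \<open>Both neighbourhoods together have at most \<open>card J + card L - 2\<close> elements, but Hall's
      condition demands \<open>card J + card L - 1\<close>.\<close>
    ultimately show False
      using card_Un_Int[OF fA fB] card_Un_Int[OF J(2) L(2)] J(4) L(4) by linarith
  qed
  have "\<exists>x. (i, x) \<in> S" if "i \<in> I" for i
  proof -
    have "S `` {i} \<noteq> {}" using hallS[of "{i}"] that by (auto simp del: Image_singleton_iff)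
    then show ?thesis by auto
  qed
  then obtain f where f: "\<And>i. i \<in> I \<Longrightarrow> (i, f i) \<in> S" by metis
  have "inj_on f I"
  proof (rule inj_onI, rule ccontr)
    fix i j assume ij: "i \<in> I" "j \<in> I" "f i = f j" "i \<noteq> j"
    have "S `` {i, j} \<subseteq> {f i}" using unique f ij by auto
    then have "card (S `` {i, j}) \<le> 1" using card_mono[of "{f i}"] by fastforce
    then show False using hallS[of "{i, j}"] ij by simp
  qed
  moreover have "f i \<in> N i" if "i \<in> I" for i using f[OF that] by (auto simp: S_def R_def)
  ultimately show thesis using that by blast
qed

section \<open>Groups of bijections\<close>

definition translates :: "('a \<Rightarrow> 'a) set \<Rightarrow> 'a set \<Rightarrow> 'a set" where
  "translates K E = (\<Union>k\<in>K. k ` E)"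

lemma finite_translates: "finite K \<Longrightarrow> finite E \<Longrightarrow> finite (translates K E)"
  by (simp add: translates_def)

lemma subgroup_BijGroup_bij_betw:
  assumes "subgroup F (BijGroup X)" "\<phi> \<in> F"
  shows "bij_betw \<phi> X X"
  using subgroup.subset[OF assms(1)] assms(2) by (auto simp: BijGroup_def Bij_def)

lemma subgroup_BijGroup_id:
  assumes "subgroup F (BijGroup X)"
  shows "(\<lambda>x\<in>X. x) \<in> F"
  using subgroup.one_closed[OF assms] by (simp add: BijGroup_def)

lemma subgroup_BijGroup_compose:
  assumes F: "subgroup F (BijGroup X)" and "\<phi> \<in> F" "\<psi> \<in> F"
  shows "compose X \<phi> \<psi> \<in> F"
proof -
  have "\<phi> \<in> Bij X" "\<psi> \<in> Bij X"
    using subgroup.subset[OF F] assms(2,3) by (auto simp: BijGroup_def)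
  then show ?thesis
    using subgroup.m_closed[OF F assms(2,3)] by (simp add: BijGroup_def)
qed

lemma subgroup_BijGroup_inverse:
  assumes F: "subgroup F (BijGroup X)" and "\<phi> \<in> F"
  shows "(\<lambda>x\<in>X. inv_into X \<phi> x) \<in> F"
proof -
  have "\<phi> \<in> Bij X"
    using subgroup.subset[OF F] assms(2) by (auto simp: BijGroup_def)
  then show ?thesis
    using subgroup.m_inv_closed[OF F assms(2)] by (simp add: inv_BijGroup)
qed

lemma translates_subset:
  assumes "subgroup F (BijGroup X)" "K \<subseteq> F" "E \<subseteq> X"
  shows "translates K E \<subseteq> X"
  using subgroup_BijGroup_bij_betw[OF assms(1)] assms(2,3)
  by (fastforce simp: translates_def bij_betw_def)

section \<open>Doubling yields a paradoxical decomposition\<close>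

text \<open>
The index set of the marriage problem consists of two copies of the carrier, and both copies of
\<open>x\<close> may be matched with any point of \<open>K {x}\<close>. The points that the matching misses are added to
the first family with the identity as their map, which makes the pieces a partition without
disturbing the cover.
\<close>

lemma doubling_imp_paradoxical:
  fixes G :: "('a, 'b) monoid_scheme"
  assumes F: "subgroup F (BijGroup (carrier G))" and K: "finite K" "K \<subseteq> F"
    and doubling: "\<And>E. E \<subseteq> carrier G \<Longrightarrow> finite E \<Longrightarrow> 2 * card E \<le> card (translates K E)"
  shows "\<exists>n m \<phi> \<psi> A B. paradoxical_decomposition G F n m \<phi> \<psi> A B"
proof -
  define X where "X = carrier G"
  note F = F[folded X_def]
  have bij: "bij_betw k X X" if "k \<in> K" for k
    using subgroup_BijGroup_bij_betw[OF F] K that by blast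
  have hall: "card J \<le> card (\<Union>j\<in>J. translates K {fst j})"
    if J: "J \<subseteq> X \<times> (UNIV :: bool set)" "finite J" for J
  proof -
    have "J \<subseteq> fst ` J \<times> UNIV" by force
    then have "card J \<le> card (fst ` J \<times> (UNIV :: bool set))"
      by (rule card_mono[rotated]) (use J in simp)
    also have "\<dots> = 2 * card (fst ` J)" by (simp add: card_cartesian_product)
    also have "\<dots> \<le> card (translates K (fst ` J))"
      by (rule doubling) (use J in \<open>auto simp: X_def\<close>)
    also have "translates K (fst ` J) = (\<Union>j\<in>J. translates K {fst j})"
      by (auto simp: translates_def)
    finally show ?thesis .
  qed
  obtain f where inj: "inj_on f (X \<times> (UNIV :: bool set))"
    and f: "\<And>p. p \<in> X \<times> UNIV \<Longrightarrow> f p \<in> translates K {fst p}"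
  proof (rule marriage[of "X \<times> (UNIV :: bool set)" "\<lambda>p. translates K {fst p}", OF _ hall])
    show "finite (translates K {fst p})" for p :: "'a \<times> bool"
      by (simp add: finite_translates K(1))
  qed (use that in blast)+
  obtain h where h: "bij_betw h {1..card K} K"
    using ex_bij_betw_nat_finite_1[OF K(1)] by blast
  define n where "n = card K"
  have ex: "\<exists>i. i \<in> {1..n} \<and> f p = h i (fst p)" if p: "p \<in> X \<times> UNIV" for p
  proof -
    obtain k where "k \<in> K" "f p = k (fst p)" using f[OF p] by (auto simp: translates_def)
    moreover have "k \<in> h ` {1..n}" using h \<open>k \<in> K\<close> by (simp add: bij_betw_def n_def)
    then obtain i where "i \<in> {1..n}" "k = h i" by (rule imageE)
    ultimately show ?thesis by metis
  qed
  obtain c where "\<forall>p\<in>X \<times> UNIV. c p \<in> {1..n} \<and> f p = h (c p) (fst p)"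
    by (rule bchoice[THEN exE, OF ballI[OF ex]])
  note c = bspec[OF this]
  have hK: "h i \<in> K" if "i \<in> {1..n}" for i
    using h that by (auto simp: n_def bij_betw_def)
  \<comment> \<open>The piece \<open>P b i\<close> collects the partners of copy \<open>b\<close> that were reached by \<open>h i\<close>; the
    inverse \<open>\<psi> i\<close> moves it back to the points that they belong to.\<close>
  define P where "P b i = (\<lambda>x. f (x, b)) ` {x \<in> X. c (x, b) = i}" for b i
  define \<psi> where "\<psi> i = (\<lambda>x\<in>X. inv_into X (h i) x)" for i
  define A where "A i = (if i = Suc n then X - f ` (X \<times> UNIV) else P True i)" for i
  define \<phi> where "\<phi> i = (if i = Suc n then (\<lambda>x\<in>X. x) else \<psi> i)" for i
  have fX: "f p \<in> X" if "p \<in> X \<times> UNIV" for p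
    using f[OF that] translates_subset[OF F K(2), of "{fst p}"] that by auto
  have \<psi>F: "\<psi> i \<in> F" if "i \<in> {1..n}" for i
    unfolding \<psi>_def using subgroup_BijGroup_inverse[OF F] hK[OF that] K by blast
  have \<psi>P: "\<psi> i ` P b i = {x \<in> X. c (x, b) = i}" if "i \<in> {1..n}" for i b
  proof -
    have "\<psi> i (f (x, b)) = x" if x: "x \<in> X" "c (x, b) = i" for x
    proof -
      have "f (x, b) = h i x" using c[of "(x, b)"] x by auto
      then show ?thesis
        using fX[of "(x, b)"] x bij[OF hK[OF \<open>i \<in> {1..n}\<close>]]
        by (simp add: \<psi>_def bij_betw_def inv_into_f_f)
    qed
    then show ?thesis by (force simp: P_def)
  qed
  have cover: "(\<Union>i\<in>{1..n}. \<psi> i ` P b i) = X" for b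
    using c[of "(_, b)"] \<psi>P by fastforce
  have PX: "P b i \<subseteq> X" for b i using fX by (auto simp: P_def)
  have Pdisj: "P b i \<inter> P b' j = {}" if "(b, i) \<noteq> (b', j)" for b b' i j
    using inj that by (auto simp: P_def inj_on_def)
  have Pun: "f ` (X \<times> UNIV) = (\<Union>i\<in>{1..n}. P True i) \<union> (\<Union>i\<in>{1..n}. P False i)"
  proof (intro equalityI subsetI)
    fix y assume "y \<in> f ` (X \<times> UNIV)"
    then obtain x b where x: "x \<in> X" "y = f (x, b)" by auto
    then have "y \<in> P b (c (x, b))" "c (x, b) \<in> {1..n}"
      using c[of "(x, b)"] x by (simp_all add: P_def image_iff, metis)
    then have "y \<in> (\<Union>i\<in>{1..n}. P b i)" by (rule UN_I[rotated])
    then show "y \<in> (\<Union>i\<in>{1..n}. P True i) \<union> (\<Union>i\<in>{1..n}. P False i)"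
      by (cases b) (simp_all only: Un_iff simp_thms)
  qed (auto simp: P_def)
  have Prange: "P b i \<subseteq> f ` (X \<times> UNIV)" for b i by (auto simp: P_def)
  have splitA: "(\<Union>i\<in>{1..Suc n}. A i) = (\<Union>i\<in>{1..n}. P True i) \<union> (X - f ` (X \<times> UNIV))"
    by (auto simp: A_def atLeastAtMostSuc_conv)
  have split\<phi>: "(\<Union>i\<in>{1..Suc n}. \<phi> i ` A i) = (\<Union>i\<in>{1..n}. \<psi> i ` P True i) \<union> (X - f ` (X \<times> UNIV))"
    by (auto simp: A_def \<phi>_def atLeastAtMostSuc_conv)
  have "paradoxical_decomposition G F (Suc n) n \<phi> \<psi> A (P False)"
    unfolding paradoxical_decomposition_def X_def[symmetric]
  proof (intro conjI)
    show "disjoint_family_on A {1..Suc n}"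
      unfolding disjoint_family_on_def
    proof (intro ballI impI)
      fix i j :: nat assume "i \<noteq> j"
      then show "A i \<inter> A j = {}"
        using Prange[of True i] Prange[of True j] Pdisj[of True i True j] by (auto simp: A_def)
    qed
    show "disjoint_family_on (P False) {1..n}"
      unfolding disjoint_family_on_def using Pdisj[of False _ False] by simp
    show "\<forall>i\<in>{1..Suc n}. \<forall>j\<in>{1..n}. A i \<inter> P False j = {}"
    proof (intro ballI)
      fix i j :: nat show "A i \<inter> P False j = {}"
        using Prange[of False j] Pdisj[of True i False j] by (auto simp: A_def)
    qed
    show "(\<Union>i\<in>{1..Suc n}. A i) \<union> (\<Union>j\<in>{1..n}. P False j) = X"
      unfolding splitA using Pun PX by auto
    show "\<forall>i\<in>{1..Suc n}. \<phi> i \<in> F"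
      using \<psi>F subgroup_BijGroup_id[OF F] by (auto simp: \<phi>_def le_Suc_eq)
    show "\<forall>j\<in>{1..n}. \<psi> j \<in> F" using \<psi>F by blast
    show "X = (\<Union>i\<in>{1..Suc n}. \<phi> i ` A i)"
      unfolding split\<phi> cover by auto
    show "X = (\<Union>j\<in>{1..n}. \<psi> j ` P False j)" by (rule cover[symmetric])
  qed
  then show ?thesis by blast
qed

section \<open>Absence of doubling yields Folner sets\<close>

lemma powers_translates:
  assumes F: "subgroup F (BijGroup X)" and K: "finite K" "K \<subseteq> F"
  shows "\<exists>P. finite P \<and> P \<subseteq> F \<and> (\<forall>E\<subseteq>X. translates P E = (translates K ^^ n) E)"
proof (induction n)
  case 0
  show ?case
    by (rule exI[of _ "{\<lambda>x\<in>X. x}"])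
      (auto simp: translates_def subgroup_BijGroup_id[OF F] subset_iff image_iff)
next
  case (Suc n)
  then obtain P where P: "finite P" "P \<subseteq> F" "\<And>E. E \<subseteq> X \<Longrightarrow> translates P E = (translates K ^^ n) E"
    by blast
  define Q where "Q = (\<Union>k\<in>K. compose X k ` P)"
  have "finite Q" using K P by (simp add: Q_def)
  moreover have "Q \<subseteq> F" using K P by (auto simp: Q_def intro!: subgroup_BijGroup_compose[OF F])
  moreover have "translates Q E = (translates K ^^ Suc n) E" if "E \<subseteq> X" for E
  proof -
    have "compose X k p ` E = k ` p ` E" for k p :: "'a \<Rightarrow> 'a"
      using that by (auto simp: compose_def image_image intro!: image_cong)
    moreover have "translates Q E = (\<Union>k\<in>K. \<Union>p\<in>P. compose X k p ` E)"
      unfolding translates_def Q_def by blast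
    ultimately have "translates Q E = translates K (translates P E)"
      by (simp add: translates_def image_UN)
    then show ?thesis using P(3)[OF that] by simp
  qed
  ultimately show ?case by blast
qed

text \<open>
If every finite set grew by the factor \<open>1 + \<epsilon>\<close> under \<open>K\<close>, then the \<open>n\<close>-th power of \<open>K\<close> would
double every finite set as soon as \<open>(1 + \<epsilon>) ^ n > 2\<close>. The strict inequality in the conclusion
forces \<open>E\<close> to be nonempty.
\<close>

lemma Folner_if_not_doubling:
  fixes \<epsilon> :: real
  assumes F: "subgroup F (BijGroup X)"
    and not_doubling: "\<And>K. finite K \<Longrightarrow> K \<subseteq> F \<Longrightarrow>
      \<exists>E\<subseteq>X. finite E \<and> card (translates K E) < 2 * card E"
    and K: "finite K" "K \<subseteq> F" and "0 < \<epsilon>"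
  shows "\<exists>E\<subseteq>X. finite E \<and> card (translates K E) < (1 + \<epsilon>) * card E"
proof (rule ccontr)
  assume "\<not> ?thesis"
  then have grow: "(1 + \<epsilon>) * card E \<le> card (translates K E)" if "E \<subseteq> X" "finite E" for E
    using that by (meson not_le)
  obtain n where n: "2 < (1 + \<epsilon>) ^ n"
    using real_arch_pow[of "1 + \<epsilon>" 2] \<open>0 < \<epsilon>\<close> by auto
  obtain P where P: "finite P" "P \<subseteq> F" "\<And>E. E \<subseteq> X \<Longrightarrow> translates P E = (translates K ^^ n) E"
    using powers_translates[OF F K, of n] by blast
  obtain E where E: "E \<subseteq> X" "finite E" "card (translates P E) < 2 * card E"
    using not_doubling[OF P(1,2)] by blast
  have "(translates K ^^ i) E \<subseteq> X \<and> finite ((translates K ^^ i) E) \<and>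
        (1 + \<epsilon>) ^ i * card E \<le> card ((translates K ^^ i) E)" for i
  proof (induction i)
    case (Suc i)
    let ?E = "(translates K ^^ i) E"
    have "(1 + \<epsilon>) ^ Suc i * card E \<le> (1 + \<epsilon>) * card ?E"
      using Suc \<open>0 < \<epsilon>\<close> by (simp add: mult.assoc)
    also have "\<dots> \<le> card (translates K ?E)" using grow Suc by blast
    finally show ?case
      using Suc translates_subset[OF F K(2)] finite_translates[OF K(1)] by simp
  qed (use E in simp)
  then have "(1 + \<epsilon>) ^ n * card E \<le> card (translates P E)" using P(3)[OF E(1)] by simp
  also have "\<dots> < 2 * card E" using E(3) by linarith
  finally show False using n by (simp add: mult_less_cancel_right)
qed

section \<open>Bounded functions and means\<close>

lemma l_infty_iff:
  "f \<in> l_infty G \<longleftrightarrow> f \<in> extensional (carrier G) \<and> (\<exists>c. \<forall>x\<in>carrier G. \<bar>f x\<bar> \<le> c)"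
  by (auto simp: l_infty_def bounded_real)

lemma l_infty_restrictI:
  assumes "\<And>x. x \<in> carrier G \<Longrightarrow> \<bar>f x\<bar> \<le> c"
  shows "(\<lambda>x\<in>carrier G. f x) \<in> l_infty G"
  using assms by (auto simp: l_infty_iff)

lemma l_infty_one: "(\<lambda>x\<in>carrier G. 1) \<in> l_infty G"
  by (rule l_infty_restrictI[where c = 1]) simp

lemma l_infty_add:
  assumes "f \<in> l_infty G" "g \<in> l_infty G"
  shows "(\<lambda>x\<in>carrier G. f x + g x) \<in> l_infty G"
proof -
  obtain c d where "\<And>x. x \<in> carrier G \<Longrightarrow> \<bar>f x\<bar> \<le> c" "\<And>x. x \<in> carrier G \<Longrightarrow> \<bar>g x\<bar> \<le> d"
    using assms by (auto simp: l_infty_iff)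
  then show ?thesis
    by (intro l_infty_restrictI[where c = "c + d"]) (meson abs_triangle_ineq add_mono order_trans)
qed

lemma l_infty_scale:
  assumes "f \<in> l_infty G"
  shows "(\<lambda>x\<in>carrier G. c * f x) \<in> l_infty G"
proof -
  obtain d where "\<And>x. x \<in> carrier G \<Longrightarrow> \<bar>f x\<bar> \<le> d"
    using assms by (auto simp: l_infty_iff)
  then show ?thesis
    by (intro l_infty_restrictI[where c = "\<bar>c\<bar> * d"]) (simp add: abs_mult mult_left_mono)
qed

lemma l_infty_sum:
  assumes "finite I" "\<And>i. i \<in> I \<Longrightarrow> f i \<in> l_infty G"
  shows "(\<lambda>x\<in>carrier G. \<Sum>i\<in>I. f i x) \<in> l_infty G"
  using assms
proof (induction I rule: finite_induct)
  case empty
  show ?case using l_infty_restrictI[of G "\<lambda>_. 0" 0] by (simp only: sum.empty abs_zero order_refl)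
next
  case (insert a I)
  have eq: "(\<lambda>x\<in>carrier G. \<Sum>i\<in>insert a I. f i x)
      = (\<lambda>x\<in>carrier G. f a x + (\<lambda>x\<in>carrier G. \<Sum>i\<in>I. f i x) x)"
    using insert.hyps by (auto simp: fun_eq_iff)
  show ?case unfolding eq by (intro l_infty_add insert.IH insert.prems) auto
qed

lemma l_infty_compose:
  assumes "f \<in> l_infty G" "\<phi> \<in> carrier G \<rightarrow> carrier G"
  shows "compose (carrier G) f \<phi> \<in> l_infty G"
  using assms unfolding compose_def by (auto simp: l_infty_iff Pi_iff)

lemma mean_on_sum:
  assumes M: "mean_on G M" and "finite I" "\<And>i. i \<in> I \<Longrightarrow> f i \<in> l_infty G"
  shows "M (\<lambda>x\<in>carrier G. \<Sum>i\<in>I. f i x) = (\<Sum>i\<in>I. M (f i))"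
  using assms(2,3)
proof (induction I rule: finite_induct)
  case empty
  have "(\<lambda>x\<in>carrier G. 1::real) \<in> l_infty G" by (rule l_infty_one)
  then have "M (\<lambda>x\<in>carrier G. 0 * (\<lambda>x\<in>carrier G. 1) x) = 0 * M (\<lambda>x\<in>carrier G. 1)"
    using M unfolding mean_on_def by blast
  moreover have "(\<lambda>x\<in>carrier G. 0 * (\<lambda>x\<in>carrier G. 1::real) x) = (\<lambda>x\<in>carrier G. 0)"
    by (simp only: mult_zero_left)
  ultimately show ?case by (simp only: sum.empty mult_zero_left)
next
  case (insert a I)
  let ?g = "\<lambda>x\<in>carrier G. \<Sum>i\<in>I. f i x"
  have eq: "(\<lambda>x\<in>carrier G. \<Sum>i\<in>insert a I. f i x) = (\<lambda>x\<in>carrier G. f a x + ?g x)"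
    using insert.hyps by (auto simp: fun_eq_iff)
  have "f a \<in> l_infty G" "?g \<in> l_infty G"
    using insert.prems by (auto intro!: l_infty_sum insert.hyps)
  then have "M (\<lambda>x\<in>carrier G. f a x + ?g x) = M (f a) + M ?g"
    using M unfolding mean_on_def by blast
  also have "M ?g = (\<Sum>i\<in>I. M (f i))" by (intro insert.IH insert.prems) auto
  finally show ?case unfolding eq using insert.hyps by simp
qed

lemma mean_on_mono:
  assumes M: "mean_on G M" and f: "f \<in> l_infty G" and g: "g \<in> l_infty G"
    and le: "\<And>x. x \<in> carrier G \<Longrightarrow> f x \<le> g x"
  shows "M f \<le> M g"
proof -
  define h where "h = (\<lambda>x\<in>carrier G. g x + (\<lambda>x\<in>carrier G. (-1) * f x) x)"
  have h: "h \<in> l_infty G" unfolding h_def by (intro l_infty_add l_infty_scale f g)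
  have "(\<lambda>x\<in>carrier G. f x + h x) = g"
    using g by (auto simp: h_def fun_eq_iff l_infty_iff extensional_def)
  then have "M g = M f + M h" using M f h unfolding mean_on_def by metis
  moreover have "0 \<le> M h" using M h le by (auto simp: mean_on_def h_def)
  ultimately show ?thesis by simp
qed

section \<open>An invariant mean excludes paradoxical decompositions\<close>

text \<open>
A point \<open>\<phi> i a\<close> with \<open>a \<in> A i\<close> is where the indicator of \<open>A i\<close>, composed with the inverse of
\<open>\<phi> i\<close>, takes the value 1. As the images cover, these composed indicators add up to at least 1
everywhere, and invariance removes the inverses from their means.
\<close>

lemma invariant_mean_cover:
  fixes G :: "('a, 'b) monoid_scheme" and A :: "'i \<Rightarrow> 'a set"
  assumes F: "subgroup F (BijGroup (carrier G))" and M: "mean_on G M"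
    and inv: "\<And>f \<phi>. f \<in> l_infty G \<Longrightarrow> \<phi> \<in> F \<Longrightarrow> M (compose (carrier G) f \<phi>) = M f"
    and I: "finite I" "\<And>i. i \<in> I \<Longrightarrow> \<phi> i \<in> F" "\<And>i. i \<in> I \<Longrightarrow> A i \<subseteq> carrier G"
    and cover: "carrier G = (\<Union>i\<in>I. \<phi> i ` A i)"
  shows "1 \<le> (\<Sum>i\<in>I. M (\<lambda>x\<in>carrier G. indicator (A i) x))"
proof -
  define u :: "'i \<Rightarrow> 'a \<Rightarrow> real" where "u i = (\<lambda>x\<in>carrier G. indicator (A i) x)" for i
  define \<rho> where "\<rho> i = (\<lambda>x\<in>carrier G. inv_into (carrier G) (\<phi> i) x)" for i
  define v where "v i = compose (carrier G) (u i) (\<rho> i)" for i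
  have u: "u i \<in> l_infty G" for i
    unfolding u_def by (rule l_infty_restrictI[where c = 1]) (simp add: indicator_def)
  have \<rho>: "\<rho> i \<in> F" if "i \<in> I" for i
    unfolding \<rho>_def using subgroup_BijGroup_inverse[OF F] I(2) that by blast
  have v: "v i \<in> l_infty G" if "i \<in> I" for i
    unfolding v_def
    using l_infty_compose[OF u] subgroup_BijGroup_bij_betw[OF F \<rho>[OF that]]
    by (simp add: bij_betw_imp_funcset)
  have "1 = M (\<lambda>x\<in>carrier G. 1)" using M by (simp add: mean_on_def)
  also have "\<dots> \<le> M (\<lambda>x\<in>carrier G. \<Sum>i\<in>I. v i x)"
  proof (rule mean_on_mono[OF M])
    show "(\<lambda>x\<in>carrier G. 1::real) \<in> l_infty G" by (rule l_infty_one)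
    show "(\<lambda>x\<in>carrier G. \<Sum>i\<in>I. v i x) \<in> l_infty G" by (rule l_infty_sum[OF I(1) v])
    fix y assume y: "y \<in> carrier G"
    have nonneg: "0 \<le> v i y" if "i \<in> I" for i
      using y subgroup_BijGroup_bij_betw[OF F \<rho>[OF that]]
      by (auto simp: v_def u_def compose_def bij_betw_def)
    obtain i a where i: "i \<in> I" "a \<in> A i" "y = \<phi> i a" using cover y by blast
    have "inj_on (\<phi> i) (carrier G)"
      using subgroup_BijGroup_bij_betw[OF F I(2)[OF i(1)]] by (simp add: bij_betw_def)
    then have "\<rho> i y = a" using i I(3) y by (auto simp: \<rho>_def subset_iff)
    then have "v i y = 1" using i I(3) y by (auto simp: v_def u_def compose_def)
    then have "1 \<le> (\<Sum>i\<in>I. v i y)"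
      using member_le_sum[of i I "\<lambda>i. v i y"] nonneg i I(1) by simp
    then show "(\<lambda>x\<in>carrier G. 1) y \<le> (\<lambda>x\<in>carrier G. \<Sum>i\<in>I. v i x) y" using y by simp
  qed
  also have "\<dots> = (\<Sum>i\<in>I. M (v i))" by (rule mean_on_sum[OF M I(1) v])
  also have "\<dots> = (\<Sum>i\<in>I. M (u i))" using inv u \<rho> by (simp add: v_def)
  finally show ?thesis by (simp add: u_def)
qed

lemma F_amenable_imp_not_paradoxical:
  fixes G :: "('a, 'b) monoid_scheme"
  assumes F: "subgroup F (BijGroup (carrier G))" and am: "F_amenable G F"
  shows "\<not> paradoxical_decomposition G F n m \<phi> \<psi> A B"
proof
  assume p: "paradoxical_decomposition G F n m \<phi> \<psi> A B"
  obtain M where M: "mean_on G M"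
    and inv: "\<And>f \<phi>. f \<in> l_infty G \<Longrightarrow> \<phi> \<in> F \<Longrightarrow> M (compose (carrier G) f \<phi>) = M f"
    using am by (auto simp: F_amenable_def)
  define I where "I = Inl ` {1..n} \<union> Inr ` {1..m}"
  define C where "C = case_sum A B"
  define u :: "'a set \<Rightarrow> 'a \<Rightarrow> real" where "u S = (\<lambda>x\<in>carrier G. indicator S x)" for S
  have u: "u S \<in> l_infty G" for S
    unfolding u_def by (rule l_infty_restrictI[where c = 1]) (simp add: indicator_def)
  have finI: "finite I" by (simp add: I_def)
  have split: "(\<Sum>s\<in>I. q (C s)) = (\<Sum>i\<in>{1..n}. q (A i)) + (\<Sum>j\<in>{1..m}. q (B j))"
    for q :: "'a set \<Rightarrow> real"
    unfolding I_def by (subst sum.union_disjoint) (auto simp: C_def sum.reindex)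
  have A: "\<phi> i \<in> F" if "i \<in> {1..n}" for i
    using p that by (simp add: paradoxical_decomposition_def)
  have B: "\<psi> j \<in> F" if "j \<in> {1..m}" for j
    using p that by (simp add: paradoxical_decomposition_def)
  have AB: "(\<Union>i\<in>{1..n}. A i) \<union> (\<Union>j\<in>{1..m}. B j) = carrier G"
    and disj: "disjoint_family_on A {1..n}" "disjoint_family_on B {1..m}"
      "\<forall>i\<in>{1..n}. \<forall>j\<in>{1..m}. A i \<inter> B j = {}"
    and coverA: "carrier G = (\<Union>i\<in>{1..n}. \<phi> i ` A i)"
    and coverB: "carrier G = (\<Union>j\<in>{1..m}. \<psi> j ` B j)"
    using p unfolding paradoxical_decomposition_def by iprover+
  have A_sub: "A i \<subseteq> carrier G" if "i \<in> {1..n}" for i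
    unfolding AB[symmetric] using UN_upper[of i "{1..n}" A] that by (simp only: le_supI1)
  have B_sub: "B j \<subseteq> carrier G" if "j \<in> {1..m}" for j
    unfolding AB[symmetric] using UN_upper[of j "{1..m}" B] that by (simp only: le_supI2)
  have "1 \<le> (\<Sum>i\<in>{1..n}. M (u (A i)))"
    unfolding u_def
    by (rule invariant_mean_cover[OF F M inv finite_atLeastAtMost A A_sub coverA])
  moreover have "1 \<le> (\<Sum>j\<in>{1..m}. M (u (B j)))"
    unfolding u_def
    by (rule invariant_mean_cover[OF F M inv finite_atLeastAtMost B B_sub coverB])
  ultimately have "2 \<le> (\<Sum>s\<in>I. M (u (C s)))" unfolding split[of "\<lambda>S. M (u S)"] by simp
  also have "\<dots> = M (\<lambda>x\<in>carrier G. \<Sum>s\<in>I. u (C s) x)"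
    using mean_on_sum[OF M finI u] by simp
  also have "\<dots> \<le> M (\<lambda>x\<in>carrier G. 1)"
  proof (rule mean_on_mono[OF M])
    show "(\<lambda>x\<in>carrier G. \<Sum>s\<in>I. u (C s) x) \<in> l_infty G" by (rule l_infty_sum[OF finI u])
    show "(\<lambda>x\<in>carrier G. 1::real) \<in> l_infty G" by (rule l_infty_one)
    fix x assume x: "x \<in> carrier G"
    have "disjoint_family_on C I"
      unfolding disjoint_family_on_def
    proof (intro ballI impI)
      fix s t assume "s \<in> I" "t \<in> I" "s \<noteq> t"
      then show "C s \<inter> C t = {}"
        using disj(3) disjoint_family_onD[OF disj(1)] disjoint_family_onD[OF disj(2)]
        by (cases s; cases t) (simp_all add: I_def C_def image_iff Int_commute)
    qed
    then have "(\<Sum>s\<in>I. indicator (C s) x) = (indicator (\<Union>s\<in>I. C s) x :: real)"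
      by (simp add: indicator_UN_disjoint finI)
    also have "\<dots> \<le> 1" by (simp add: indicator_def)
    finally show "(\<lambda>x\<in>carrier G. \<Sum>s\<in>I. u (C s) x) x \<le> (\<lambda>x\<in>carrier G. 1) x"
      using x by (simp add: u_def)
  qed
  also have "\<dots> = 1" using M by (simp add: mean_on_def)
  finally show False by simp
qed

section \<open>Folner sets yield an invariant mean\<close>

text \<open>
The value 0 off \<open>l_infty\<close> keeps the average of every function within bounds that do not depend on
\<open>E\<close>, so that all averages lie in one compact product of intervals.
\<close>

definition average :: "('a, 'b) monoid_scheme \<Rightarrow> 'a set \<Rightarrow> ('a \<Rightarrow> real) \<Rightarrow> real" where
  "average G E f = (if f \<in> l_infty G then (\<Sum>x\<in>E. f x) / card E else 0)"

lemma mean_on_average: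
  assumes E: "E \<subseteq> carrier G" "finite E" "E \<noteq> {}"
  shows "mean_on G (average G E)"
proof -
  have cong: "(\<Sum>x\<in>E. (\<lambda>x\<in>carrier G. f x) x) = (\<Sum>x\<in>E. f x)" for f :: "'a \<Rightarrow> real"
    using E by (intro sum.cong) auto
  have one: "(\<lambda>x\<in>carrier G. 1::real) \<in> l_infty G" by (rule l_infty_one)
  have scale: "average G E (\<lambda>x\<in>carrier G. c * f x) = c * average G E f" if "f \<in> l_infty G" for c f
    using l_infty_scale[OF that] that
    by (simp only: average_def cong if_True sum_distrib_left[symmetric] times_divide_eq_right)
  have nonneg: "0 \<le> average G E f" if "\<forall>x\<in>carrier G. 0 \<le> f x" for f
    using that E unfolding average_def by (auto intro!: divide_nonneg_nonneg sum_nonneg)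
  have add: "average G E (\<lambda>x\<in>carrier G. f x + g x) = average G E f + average G E g"
    if "f \<in> l_infty G" "g \<in> l_infty G" for f g
    using l_infty_add[OF that] that by (simp only: average_def cong if_True sum.distrib add_divide_distrib)
  have "average G E (\<lambda>x\<in>carrier G. 1) = 1"
    using one E unfolding average_def by (simp only: cong if_True) simp
  then show ?thesis using scale nonneg add by (auto simp: mean_on_def)
qed

lemma average_bound:
  fixes b :: real
  assumes E: "E \<subseteq> carrier G" "finite E" "E \<noteq> {}"
    and b: "\<And>x. x \<in> carrier G \<Longrightarrow> \<bar>f x\<bar> \<le> b" and f: "f \<in> l_infty G"
  shows "\<bar>average G E f\<bar> \<le> b"
proof -
  have "\<bar>\<Sum>x\<in>E. f x\<bar> \<le> (\<Sum>x\<in>E. b)"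
    using b E by (intro order_trans[OF sum_abs] sum_mono) auto
  then show ?thesis using E f by (simp add: average_def field_simps card_gt_0_iff)
qed

lemma sum_almost_all_bound:
  fixes f :: "'a \<Rightarrow> real" and b \<epsilon> :: real
  assumes "finite T" "E \<subseteq> T" "real (card T) \<le> (1 + \<epsilon>) * card E"
    and b: "\<And>x. x \<in> T \<Longrightarrow> \<bar>f x\<bar> \<le> b" and "0 \<le> b"
  shows "\<bar>sum f T - sum f E\<bar> \<le> \<epsilon> * b * card E"
proof -
  have "sum f T - sum f E = sum f (T - E)" using assms by (simp add: sum_diff)
  moreover have "\<bar>sum f (T - E)\<bar> \<le> (\<Sum>x\<in>T - E. b)"
    using b by (intro order_trans[OF sum_abs] sum_mono) auto
  moreover have "card (T - E) = real (card T) - real (card E)"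
    using assms by (simp add: card_Diff_subset finite_subset of_nat_diff card_mono)
  then have "card (T - E) * b \<le> (\<epsilon> * card E) * b"
    using assms by (intro mult_right_mono) (auto simp: algebra_simps)
  ultimately show ?thesis by (simp add: ac_simps)
qed

text \<open>
The sums over \<open>E\<close> and over \<open>k ` E\<close> are both compared with the sum over \<open>K E\<close>, which contains
both sets (\<open>E\<close> because the identity is in \<open>K\<close>) and is only slightly larger than either.
\<close>

lemma average_almost_invariant:
  fixes G :: "('a, 'b) monoid_scheme" and b \<epsilon> :: real
  assumes F: "subgroup F (BijGroup (carrier G))" and K: "finite K" "K \<subseteq> F" "(\<lambda>x\<in>carrier G. x) \<in> K"
    and E: "E \<subseteq> carrier G" "finite E" "E \<noteq> {}"
    and small: "card (translates K E) < (1 + \<epsilon>) * card E"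
    and f: "f \<in> l_infty G" and b: "\<And>x. x \<in> carrier G \<Longrightarrow> \<bar>f x\<bar> \<le> b" and "0 \<le> b"
    and k: "k \<in> K"
  shows "\<bar>average G E (compose (carrier G) f k) - average G E f\<bar> \<le> 2 * \<epsilon> * b"
proof -
  let ?T = "translates K E"
  have bij: "bij_betw k (carrier G) (carrier G)"
    using subgroup_BijGroup_bij_betw[OF F] K k by blast
  then have inj: "inj_on k E" using E by (meson bij_betw_def inj_on_subset)
  have T: "finite ?T" "?T \<subseteq> carrier G"
    using finite_translates[OF K(1) E(2)] translates_subset[OF F K(2) E(1)] by auto
  have "(\<lambda>x\<in>carrier G. x) ` E = E" using E by force
  then have ET: "E \<subseteq> ?T" using K(3) unfolding translates_def by blast
  have kT: "k ` E \<subseteq> ?T" using k by (auto simp: translates_def)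
  have "\<bar>sum f ?T - sum f E\<bar> \<le> \<epsilon> * b * card E"
    by (rule sum_almost_all_bound) (use T ET small b \<open>0 \<le> b\<close> in auto)
  moreover have "\<bar>sum f ?T - sum f (k ` E)\<bar> \<le> \<epsilon> * b * card (k ` E)"
    by (rule sum_almost_all_bound) (use T kT small b \<open>0 \<le> b\<close> in \<open>auto simp: card_image[OF inj]\<close>)
  ultimately have "\<bar>sum f (k ` E) - sum f E\<bar> \<le> 2 * \<epsilon> * b * card E"
    by (simp add: card_image[OF inj])
  moreover have "(\<Sum>x\<in>E. compose (carrier G) f k x) = sum f (k ` E)"
    using E by (subst sum.reindex[OF inj]) (auto simp: compose_def intro!: sum.cong)
  moreover have "compose (carrier G) f k \<in> l_infty G"
    using l_infty_compose[OF f bij_betw_imp_funcset[OF bij]] .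
  ultimately show ?thesis
    using f E by (simp add: average_def diff_divide_distrib[symmetric] field_simps card_gt_0_iff)
qed

text \<open>
A functional is a point of the product of copies of the real line indexed by all functions. By
Tychonoff's theorem the bounds cut out a compact set, and the axioms of a mean are closed
conditions because each is an equation or a non-strict inequality between finitely many coordinates.
\<close>

lemma compact_bounded_means: "compact {M. mean_on G M \<and> (\<forall>f. \<bar>M f\<bar> \<le> b f)}"
proof -
  have "compactin (product_topology (\<lambda>i. euclidean) UNIV) (PiE UNIV (\<lambda>f. {- b f..b f}))"
    by (simp add: compactin_PiE)
  then have P: "compact (PiE UNIV (\<lambda>f. {- b f..b f}))"
    by (simp add: euclidean_product_topology)
  have "closed {M. mean_on G M}"
    unfolding mean_on_def Ball_def
    by (intro closed_Collect_conj closed_Collect_all closed_Collect_imp closed_Collect_eq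
        closed_Collect_le continuous_intros continuous_on_product_coordinates open_Collect_const)
  with P have "compact (PiE UNIV (\<lambda>f. {- b f..b f}) \<inter> {M. mean_on G M})"
    by (rule compact_Int_closed)
  moreover have "PiE UNIV (\<lambda>f. {- b f..b f}) \<inter> {M. mean_on G M}
      = {M. mean_on G M \<and> (\<forall>f. \<bar>M f\<bar> \<le> b f)}"
    by (auto simp: PiE_iff abs_le_iff minus_le_iff)
  ultimately show ?thesis by simp
qed

text \<open>
For each \<open>k \<in> F\<close> and each tolerance, the functionals invariant under \<open>k\<close> up to that tolerance
form a closed set. Finitely many such sets have the average over one sufficiently invariant
Folner set in common, so by compactness all of them share a mean, which is invariant exactly.
\<close>

lemma Folner_imp_F_amenable:
  fixes G :: "('a, 'b) monoid_scheme"
  assumes F: "subgroup F (BijGroup (carrier G))"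
    and Folner: "\<And>K (\<epsilon> :: real). finite K \<Longrightarrow> K \<subseteq> F \<Longrightarrow> 0 < \<epsilon> \<Longrightarrow>
      \<exists>E\<subseteq>carrier G. finite E \<and> card (translates K E) < (1 + \<epsilon>) * card E"
  shows "F_amenable G F"
proof -
  have "\<exists>c\<ge>0::real. f \<in> l_infty G \<longrightarrow> (\<forall>x\<in>carrier G. \<bar>f x\<bar> \<le> c)" for f
    by (auto simp: l_infty_iff) (meson abs_ge_self abs_ge_zero order_trans)
  then obtain b where b0: "\<And>f. 0 \<le> b f"
    and b: "\<And>f x. f \<in> l_infty G \<Longrightarrow> x \<in> carrier G \<Longrightarrow> \<bar>f x\<bar> \<le> b f"
    by metis
  define U where "U = {M. mean_on G M \<and> (\<forall>f. \<bar>M f\<bar> \<le> b f)}"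
  define T where "T = (\<lambda>(k, \<epsilon>). {M. \<forall>f\<in>l_infty G.
    \<bar>M (compose (carrier G) f k) - M f\<bar> \<le> 2 * \<epsilon> * b f})"
  have "U \<inter> (\<Inter>i\<in>F \<times> {0<..}. T i) \<noteq> {}"
  proof (rule compact_imp_fip_image)
    show "compact U" unfolding U_def by (rule compact_bounded_means)
    show "closed (T i)" for i
      unfolding T_def Ball_def case_prod_unfold
      by (intro closed_Collect_all closed_Collect_imp closed_Collect_le open_Collect_const
          continuous_intros continuous_on_product_coordinates)
    fix I' assume I': "finite I'" "I' \<subseteq> F \<times> {0::real<..}"
    define K where "K = insert (\<lambda>x\<in>carrier G. x) (fst ` I')"
    define \<epsilon> where "\<epsilon> = Min (insert 1 (snd ` I'))"
    have K: "finite K" "K \<subseteq> F" "(\<lambda>x\<in>carrier G. x) \<in> K"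
      using I' subgroup_BijGroup_id[OF F] by (auto simp: K_def)
    have "0 < \<epsilon>" unfolding \<epsilon>_def using I' by (subst Min_gr_iff) auto
    then obtain E where E: "E \<subseteq> carrier G" "finite E" "card (translates K E) < (1 + \<epsilon>) * card E"
      using Folner[OF K(1,2)] by blast
    then have "E \<noteq> {}" by (auto simp: translates_def)
    have "average G E \<in> U"
      using mean_on_average[OF E(1,2) \<open>E \<noteq> {}\<close>] average_bound[OF E(1,2) \<open>E \<noteq> {}\<close>] b b0
      by (auto simp: U_def) (metis abs_zero average_def)
    moreover have "average G E \<in> T (k, \<delta>)" if "(k, \<delta>) \<in> I'" for k \<delta>
    proof -
      have "k \<in> K" using that by (force simp: K_def)
      have "\<epsilon> \<le> \<delta>" unfolding \<epsilon>_def using I' that by (intro Min_le) force+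
      then have le: "2 * \<epsilon> * b f \<le> 2 * \<delta> * b f" for f by (intro mult_right_mono b0) simp
      have "\<bar>average G E (compose (carrier G) f k) - average G E f\<bar> \<le> 2 * \<epsilon> * b f"
        if f: "f \<in> l_infty G" for f
        by (rule average_almost_invariant[OF F K E(1,2) \<open>E \<noteq> {}\<close> E(3) f b[OF f] b0 \<open>k \<in> K\<close>])
      then show ?thesis unfolding T_def using le by (blast intro: order_trans)
    qed
    ultimately show "U \<inter> (\<Inter>i\<in>I'. T i) \<noteq> {}" by auto
  qed
  then obtain M where M: "mean_on G M" and T: "\<And>k \<epsilon>. k \<in> F \<Longrightarrow> 0 < \<epsilon> \<Longrightarrow> M \<in> T (k, \<epsilon>)"
    by (auto simp: U_def)
  have "M (compose (carrier G) f k) = M f" if "f \<in> l_infty G" "k \<in> F" for f k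
  proof -
    have "\<bar>M (compose (carrier G) f k) - M f\<bar> \<le> 0 + e" if "0 < e" for e
    proof -
      have "0 < b f + 1" using b0[of f] by simp
      have "\<bar>M (compose (carrier G) f k) - M f\<bar> \<le> 2 * (e / (2 * (b f + 1))) * b f"
        using T[OF \<open>k \<in> F\<close>, of "e / (2 * (b f + 1))"] \<open>f \<in> l_infty G\<close> \<open>0 < e\<close> \<open>0 < b f + 1\<close>
        by (auto simp: T_def)
      also have "\<dots> \<le> e" using \<open>0 < b f + 1\<close> \<open>0 < e\<close> by (simp add: field_simps)
      finally show ?thesis by simp
    qed
    then have "\<bar>M (compose (carrier G) f k) - M f\<bar> \<le> 0" by (rule field_le_epsilon)
    then show ?thesis by simp
  qed
  then show ?thesis using M by (auto simp: F_amenable_def)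
qed

theorem theorem3p2:
  fixes G :: "('a, 'b) monoid_scheme" and F :: "('a \<Rightarrow> 'a) set"
  assumes "group G" and "subgroup F (BijGroup (carrier G))"
  shows "F_amenable G F \<longleftrightarrow>
    \<not> (\<exists>n m \<phi> \<psi> A B. paradoxical_decomposition G F n m \<phi> \<psi> A B)"
proof
  show "\<not> (\<exists>n m \<phi> \<psi> A B. paradoxical_decomposition G F n m \<phi> \<psi> A B)" if "F_amenable G F"
    using F_amenable_imp_not_paradoxical[OF assms(2) that] by blast
  assume no_paradox: "\<not> (\<exists>n m \<phi> \<psi> A B. paradoxical_decomposition G F n m \<phi> \<psi> A B)"
  have "\<exists>E\<subseteq>carrier G. finite E \<and> card (translates K E) < 2 * card E"
    if "finite K" "K \<subseteq> F" for K
    using doubling_imp_paradoxical[OF assms(2) that] no_paradox by (meson not_le)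
  then show "F_amenable G F"
    by (intro Folner_imp_F_amenable[OF assms(2)] Folner_if_not_doubling[OF assms(2)])
qed

end
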